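(* With fixed parameters $q,T$, HP2 performs better than QP and TP2 in terms of average order delay. That is, letting $AOD_{HP2}$, $AOD_{QP}$, $AOD_{TP2}$ denote the average order delays of HP2 with parameters $(q,T)$, QP with parameter $q$, and TP2 with parameter $T$, $$AOD_{HP2}<AOD_{QP}\quad\text{and}\quad AOD_{HP2}<AOD_{TP2}.$$
   Context: Customer orders arrive according to a Poisson process $\{N(t)\}_{t\ge 0}$ with rate $\lambda>0$ and $N(0)=0$; $\tau_n$ denotes the arrival time of the $n$-th order, and $a\wedge b=\min(a,b)$. A renewal-type clearing policy is specified by its shipment-release time $\tau$ (the length of one consolidation cycle started at time $0$), a stopping time of the natural filtration of $N$ with $0<\mathbb{E}[\tau]<\infty$. Its average order delay is $AOD_\tau=\mathbb{E}\left[\int_0^\tau N(u)\,du\right]/(\lambda\,\mathbb{E}[\tau])$; a policy performs better than another in terms of average order delay if its average order delay is smaller. The policies are: QP with parameter $q$ (an integer, $q\ge1$): $\tau=\tau_q$; TP2 with parameter $T>0$: $\tau=\tau_1+T$; HP2 with parameters $q$ (an integer, $q\ge1$) and $T>0$: $\tau=\tau_q\wedge(\tau_1+T)$.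
   Formalization: The strict inequality AOD_HP2 < AOD_QP is claimed only for q ≥ 2: for q = 1 the policies HP2 and QP coincide (τ_1 ∧ (τ_1+T) = τ_1), so both average order delays are 0 and the strict inequality fails. The comparison with TP2 is claimed for all q ≥ 1. *)

theory Defs
  imports "HOL-Probability.Probability"
begin

text \<open>
  Time is indexed by the reals and only indices \<open>t \<ge> 0\<close> matter. Natural-number subtraction in the
  increments is harmless because paths are nondecreasing.
\<close>

locale poisson_process = prob_space M
  for M :: "'a measure" and rate :: real and N :: "real \<Rightarrow> 'a \<Rightarrow> nat" +
  assumes rate_pos: "0 < rate"
    and N_measurable: "\<And>t. 0 \<le> t \<Longrightarrow> N t \<in> measurable M (count_space UNIV)"
    and N_zero: "\<And>\<omega>. \<omega> \<in> space M \<Longrightarrow> N 0 \<omega> = 0"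
    and N_mono: "\<And>s t \<omega>. \<omega> \<in> space M \<Longrightarrow> 0 \<le> s \<Longrightarrow> s \<le> t \<Longrightarrow> N s \<omega> \<le> N t \<omega>"
    and N_right_continuous:
      "\<And>t \<omega>. \<omega> \<in> space M \<Longrightarrow> 0 \<le> t \<Longrightarrow> continuous (at_right t) (\<lambda>s. N s \<omega>)"
    and N_increments: "\<And>s t. 0 \<le> s \<Longrightarrow> s < t \<Longrightarrow>
      distr M (count_space UNIV) (\<lambda>\<omega>. N t \<omega> - N s \<omega>) = measure_pmf (poisson_pmf (rate * (t - s)))"
    and N_indep_increments: "\<And>n (ts :: nat \<Rightarrow> real). 0 \<le> ts 0 \<Longrightarrow> (\<And>i. i < n \<Longrightarrow> ts i \<le> ts (Suc i)) \<Longrightarrow>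
      indep_vars (\<lambda>_. count_space UNIV) (\<lambda>i \<omega>. N (ts (Suc i)) \<omega> - N (ts i) \<omega>) {..<n}"

text \<open>
  Random times take values in \<^typ>\<open>ennreal\<close>: on the null set of outcomes with fewer than \<open>n\<close>
  orders the \<open>n\<close>-th arrival time is \<open>\<infinity>\<close>, the infimum of the empty set.
\<close>

definition arrival_time :: "(real \<Rightarrow> 'a \<Rightarrow> nat) \<Rightarrow> nat \<Rightarrow> 'a \<Rightarrow> ennreal" where
  "arrival_time N n \<omega> = Inf {ennreal t | t. 0 \<le> t \<and> n \<le> N t \<omega>}"

definition natural_filtration :: "'a measure \<Rightarrow> (real \<Rightarrow> 'a \<Rightarrow> nat) \<Rightarrow> ennreal \<Rightarrow> 'a measure" where
  "natural_filtration M N t =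
    sigma (space M) {N s -` A \<inter> space M | s A. 0 \<le> s \<and> ennreal s \<le> t}"

definition clearing_policy :: "'a measure \<Rightarrow> (real \<Rightarrow> 'a \<Rightarrow> nat) \<Rightarrow> ('a \<Rightarrow> ennreal) \<Rightarrow> bool" where
  "clearing_policy M N \<tau> \<longleftrightarrow>
    stopping_time (natural_filtration M N) \<tau> \<and>
    0 < (\<integral>\<^sup>+\<omega>. \<tau> \<omega> \<partial>M) \<and> (\<integral>\<^sup>+\<omega>. \<tau> \<omega> \<partial>M) < \<infinity>"

definition AOD :: "'a measure \<Rightarrow> real \<Rightarrow> (real \<Rightarrow> 'a \<Rightarrow> nat) \<Rightarrow> ('a \<Rightarrow> ennreal) \<Rightarrow> ennreal" where
  "AOD M rate N \<tau> =
    (\<integral>\<^sup>+\<omega>. (\<integral>\<^sup>+u. of_nat (N u \<omega>) * indicator {u. 0 \<le> u \<and> ennreal u \<le> \<tau> \<omega>} u \<partial>lborel) \<partial>M)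
      / (ennreal rate * (\<integral>\<^sup>+\<omega>. \<tau> \<omega> \<partial>M))"

definition QP :: "(real \<Rightarrow> 'a \<Rightarrow> nat) \<Rightarrow> nat \<Rightarrow> 'a \<Rightarrow> ennreal" where
  "QP N q = arrival_time N q"

definition TP2 :: "(real \<Rightarrow> 'a \<Rightarrow> nat) \<Rightarrow> real \<Rightarrow> 'a \<Rightarrow> ennreal" where
  "TP2 N T \<omega> = arrival_time N 1 \<omega> + ennreal T"

definition HP2 :: "(real \<Rightarrow> 'a \<Rightarrow> nat) \<Rightarrow> nat \<Rightarrow> real \<Rightarrow> 'a \<Rightarrow> ennreal" where
  "HP2 N q T \<omega> = min (arrival_time N q \<omega>) (arrival_time N 1 \<omega> + ennreal T)"

text \<open>For \<open>q = 1\<close> the two policies coincide, so no strict comparison between them can hold.\<close>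

lemma HP2_one_eq_QP_one: "HP2 N 1 T = QP N 1"
  by (rule ext) (simp add: HP2_def QP_def)

text \<open>
  The three policies are clearing policies, so the quotient defining \<^const>\<open>AOD\<close> is never
  degenerate for them.
\<close>

context poisson_process
begin

lemma arrival_time_le_iff:
  assumes "\<omega> \<in> space M" "0 \<le> r"
  shows "arrival_time N n \<omega> \<le> ennreal r \<longleftrightarrow> n \<le> N r \<omega>"
proof
  assume "n \<le> N r \<omega>"
  then show "arrival_time N n \<omega> \<le> ennreal r"
    unfolding arrival_time_def using assms by (intro Inf_lower) auto
next
  assume le: "arrival_time N n \<omega> \<le> ennreal r"
  show "n \<le> N r \<omega>"
  proof (rule ccontr)
    assume lt: "\<not> n \<le> N r \<omega>"
    have "((\<lambda>s. N s \<omega>) \<longlongrightarrow> N r \<omega>) (at_right r)"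
      using N_right_continuous[OF assms] by (simp add: continuous_within)
    then have "eventually (\<lambda>s. N s \<omega> = N r \<omega>) (at_right r)"
      by (simp add: tendsto_discrete)
    then obtain b where b: "b > r" "\<And>s. r < s \<Longrightarrow> s < b \<Longrightarrow> N s \<omega> = N r \<omega>"
      by (auto simp: eventually_at_right_field)
    have "ennreal b \<le> arrival_time N n \<omega>"
      unfolding arrival_time_def
    proof (rule Inf_greatest, safe)
      fix t :: real assume t: "0 \<le> t" "n \<le> N t \<omega>"
      show "ennreal b \<le> ennreal t"
      proof (rule ccontr)
        assume "\<not> ennreal b \<le> ennreal t"
        then have tb: "t < b" using t by (simp add: ennreal_le_iff not_le)
        have "N t \<omega> \<le> N r \<omega>"
          using b(2)[of t] N_mono[of \<omega> t r] t(1) tb assms by (cases "r < t") auto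
        with lt t show False by simp
      qed
    qed
    with le have "ennreal b \<le> ennreal r" by simp
    with b(1) assms show False by (simp add: ennreal_le_iff)
  qed
qed

lemma sets_natural_filtration:
  "sets (natural_filtration M N t) =
    sigma_sets (space M) {N s -` A \<inter> space M | s A. 0 \<le> s \<and> ennreal s \<le> t}"
  unfolding natural_filtration_def by (rule sets_measure_of) auto

lemma space_natural_filtration: "space (natural_filtration M N t) = space M"
  unfolding natural_filtration_def by (rule space_measure_of) auto

lemma sets_natural_filtration_subset: "sets (natural_filtration M N t) \<subseteq> sets M"
  unfolding sets_natural_filtration
  by (intro sets.sigma_sets_subset) (auto intro!: measurable_sets[OF N_measurable])

lemma pred_natural_filtration:
  assumes "0 \<le> s" "ennreal s \<le> t" shows "Measurable.pred (natural_filtration M N t) (\<lambda>\<omega>. n \<le> N s \<omega>)"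
proof -
  have "N s -` {n..} \<inter> space M \<in> sets (natural_filtration M N t)"
    unfolding sets_natural_filtration using assms by (intro sigma_sets.Basic) auto
  also have "N s -` {n..} \<inter> space M = {\<omega> \<in> space M. n \<le> N s \<omega>}" by auto
  finally show ?thesis by (simp add: pred_def space_natural_filtration)
qed

lemma stopping_time_arrival: "stopping_time (natural_filtration M N) (arrival_time N n)"
proof (rule stopping_timeI)
  fix t :: ennreal
  show "Measurable.pred (natural_filtration M N t) (\<lambda>\<omega>. arrival_time N n \<omega> \<le> t)"
  proof (cases t)
    case (real r)
    have eq: "(arrival_time N n \<omega> \<le> t) = (n \<le> N r \<omega>)"
      if "\<omega> \<in> space (natural_filtration M N t)" for \<omega>
      using arrival_time_le_iff[of \<omega> r n] that real by (simp add: space_natural_filtration)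
    have "Measurable.pred (natural_filtration M N t) (\<lambda>\<omega>. n \<le> N r \<omega>)"
      using real by (intro pred_natural_filtration) auto
    then show ?thesis by (simp add: measurable_cong[OF eq])
  qed simp
qed

lemma stopping_time_TP2:
  assumes "0 < T" shows "stopping_time (natural_filtration M N) (TP2 N T)"
proof (rule stopping_timeI)
  fix t :: ennreal
  show "Measurable.pred (natural_filtration M N t) (\<lambda>\<omega>. TP2 N T \<omega> \<le> t)"
  proof (cases t)
    case (real r)
    show ?thesis
    proof (cases "T \<le> r")
      case True
      have eq: "(TP2 N T \<omega> \<le> t) = (1 \<le> N (r - T) \<omega>)" if "\<omega> \<in> space M" for \<omega>
      proof -
        have "t = ennreal (r - T) + ennreal T"
          using True assms real by (simp add: ennreal_plus[symmetric] del: ennreal_plus)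
        then have "(TP2 N T \<omega> \<le> t) = (arrival_time N 1 \<omega> \<le> ennreal (r - T))"
          by (simp add: TP2_def ennreal_add_left_cancel_le add.commute[of _ "ennreal T"])
        then show ?thesis using arrival_time_le_iff[OF that, of "r - T" 1] True by simp
      qed
      have "Measurable.pred (natural_filtration M N t) (\<lambda>\<omega>. 1 \<le> N (r - T) \<omega>)"
        using True real assms by (intro pred_natural_filtration) (auto intro!: ennreal_leI)
      then show ?thesis
        by (subst measurable_cong[OF eq]) (auto simp: space_natural_filtration)
    next
      case False
      have "\<not> TP2 N T \<omega> \<le> t" for \<omega>
      proof
        assume "TP2 N T \<omega> \<le> t"
        moreover have "ennreal T \<le> TP2 N T \<omega>"
          unfolding TP2_def by (rule add_increasing) simp_all
        ultimately have "ennreal T \<le> t" by (rule order_trans[rotated])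
        with False real show False by (simp add: ennreal_le_iff)
      qed
      then show ?thesis by simp
    qed
  qed simp
qed

lemma stopping_time_HP2:
  assumes "0 < T" shows "stopping_time (natural_filtration M N) (HP2 N q T)"
  using stopping_time_min[OF stopping_time_arrival[of q] stopping_time_TP2[OF assms]]
  by (simp add: HP2_def[abs_def] TP2_def)

lemma random_time_measurable:
  "stopping_time (natural_filtration M N) \<tau> \<Longrightarrow> \<tau> \<in> borel_measurable M"
  by (rule measurable_stopping_time[OF _ sets_natural_filtration_subset space_natural_filtration])

lemma emeasure_N:
  assumes "0 < u"
  shows "emeasure M {\<omega> \<in> space M. N u \<omega> = k} = ennreal ((rate * u) ^ k / fact k * exp (- (rate * u)))"
proof -
  have m: "(\<lambda>\<omega>. N u \<omega> - N 0 \<omega>) \<in> measurable M (count_space UNIV)"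
    using N_measurable[of u] assms
    by (subst measurable_cong[where g = "N u"]) (auto simp: N_zero)
  have "emeasure M {\<omega> \<in> space M. N u \<omega> = k} =
      emeasure (distr M (count_space UNIV) (\<lambda>\<omega>. N u \<omega> - N 0 \<omega>)) {k}"
    using m by (subst emeasure_distr) (auto simp: N_zero intro!: arg_cong[where f = "emeasure M"])
  also have "\<dots> = emeasure (measure_pmf (poisson_pmf (rate * u))) {k}"
    using N_increments[of 0 u] assms by simp
  also have "\<dots> = ennreal ((rate * u) ^ k / fact k * exp (- (rate * u)))"
    using assms rate_pos by (simp add: emeasure_pmf_single)
  finally show ?thesis .
qed

lemma nn_integral_arrival_time: "(\<integral>\<^sup>+\<omega>. arrival_time N n \<omega> \<partial>M) = ennreal (real n / rate)"
proof -
  interpret P: pair_sigma_finite M "lborel :: real measure" ..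
  have [measurable]: "arrival_time N n \<in> borel_measurable M"
    by (rule random_time_measurable[OF stopping_time_arrival])
  have len: "(\<integral>\<^sup>+u. indicator {u. 0 < u \<and> ennreal u < x} u \<partial>lborel) = x" for x :: ennreal
  proof (cases x)
    case (real r)
    then have "{u. 0 < u \<and> ennreal u < x} = {0<..<r}" by (auto simp: ennreal_less_iff)
    with real show ?thesis by simp
  next
    case top
    then have eq: "{u. 0 < u \<and> ennreal u < x} = {0<..}" by auto
    have le: "of_nat n \<le> emeasure lborel {0::real<..}" for n
    proof -
      have "emeasure lborel {0<..<real n} \<le> emeasure lborel {0::real<..}"
        by (rule emeasure_mono) auto
      then show ?thesis by (simp add: ennreal_of_nat_eq_real_of_nat)
    qed
    have "emeasure lborel {0::real<..} = top"
      using ennreal_Ex_less_of_nat[of "emeasure lborel {0::real<..}"] le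
      by (auto simp: less_top[symmetric] not_less[symmetric])
    with top eq show ?thesis by simp
  qed
  have "(\<integral>\<^sup>+\<omega>. arrival_time N n \<omega> \<partial>M) =
      (\<integral>\<^sup>+\<omega>. (\<integral>\<^sup>+u. indicator {u. 0 < u \<and> ennreal u < arrival_time N n \<omega>} u \<partial>lborel) \<partial>M)"
    by (simp only: len)
  also have "\<dots> = (\<integral>\<^sup>+u. (\<integral>\<^sup>+\<omega>. indicator {u. 0 < u \<and> ennreal u < arrival_time N n \<omega>} u \<partial>M) \<partial>lborel)"
    by (rule P.Fubini'[symmetric]) (simp add: indicator_def, measurable)
  also have "\<dots> = (\<integral>\<^sup>+u. (\<Sum>k<n. ennreal (erlang_density k rate u / rate)) \<partial>lborel)"
  proof (rule nn_integral_cong_AE)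
    have "AE u in lborel. u \<noteq> (0::real)" by (rule AE_lborel_singleton)
    then show "AE u in lborel. (\<integral>\<^sup>+\<omega>. indicator {u. 0 < u \<and> ennreal u < arrival_time N n \<omega>} u \<partial>M)
        = (\<Sum>k<n. ennreal (erlang_density k rate u / rate))"
    proof eventually_elim
      fix u :: real assume "u \<noteq> 0"
      show "(\<integral>\<^sup>+\<omega>. indicator {u. 0 < u \<and> ennreal u < arrival_time N n \<omega>} u \<partial>M)
        = (\<Sum>k<n. ennreal (erlang_density k rate u / rate))"
      proof (cases "0 < u")
        case False
        with \<open>u \<noteq> 0\<close> show ?thesis by (simp add: erlang_density_def)
      next
        case True
        have [measurable]: "N u \<in> measurable M (count_space UNIV)" using N_measurable True by simp
        have "(\<integral>\<^sup>+\<omega>. indicator {u. 0 < u \<and> ennreal u < arrival_time N n \<omega>} u \<partial>M) =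
            (\<integral>\<^sup>+\<omega>. (\<Sum>k<n. indicator {\<omega> \<in> space M. N u \<omega> = k} \<omega>) \<partial>M)"
        proof (rule nn_integral_cong)
          fix \<omega> assume w: "\<omega> \<in> space M"
          have "(ennreal u < arrival_time N n \<omega>) = (N u \<omega> < n)"
            using arrival_time_le_iff[OF w, of u n] True by (simp add: not_le[symmetric])
          then show "indicator {u. 0 < u \<and> ennreal u < arrival_time N n \<omega>} u =
              (\<Sum>k<n. indicator {\<omega> \<in> space M. N u \<omega> = k} \<omega> :: ennreal)"
            using w True by (simp add: indicator_def)
        qed
        also have "\<dots> = (\<Sum>k<n. emeasure M {\<omega> \<in> space M. N u \<omega> = k})"
          by (subst nn_integral_sum) auto
        also have "\<dots> = (\<Sum>k<n. ennreal (erlang_density k rate u / rate))"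
          using True rate_pos
          by (intro sum.cong refl)
             (simp add: emeasure_N erlang_density_def field_simps power_mult_distrib)
        finally show ?thesis .
      qed
    qed
  qed
  also have "\<dots> = (\<Sum>k<n. (\<integral>\<^sup>+u. ennreal (erlang_density k rate u / rate) \<partial>lborel))"
    by (rule nn_integral_sum) simp
  also have "\<dots> = (\<Sum>k<n. ennreal (1 / rate))"
  proof (rule sum.cong[OF refl])
    fix k
    have "(\<integral>\<^sup>+u. ennreal (erlang_density k rate u / rate) \<partial>lborel) =
        (\<integral>\<^sup>+u. ennreal (1 / rate) * ennreal (erlang_density k rate u) \<partial>lborel)"
      using rate_pos by (intro nn_integral_cong) (simp add: ennreal_mult[symmetric])
    also have "\<dots> = ennreal (1 / rate) * (\<integral>\<^sup>+u. ennreal (erlang_density k rate u) \<partial>lborel)"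
      by (rule nn_integral_cmult) simp
    also have "(\<integral>\<^sup>+u. ennreal (erlang_density k rate u) \<partial>lborel) = 1"
      using nn_integral_erlang_ith_moment[OF rate_pos, of k 0] by simp
    finally show "(\<integral>\<^sup>+u. ennreal (erlang_density k rate u / rate) \<partial>lborel) = ennreal (1 / rate)" by simp
  qed
  also have "\<dots> = ennreal (real n / rate)"
    using rate_pos by (simp add: ennreal_of_nat_eq_real_of_nat ennreal_mult[symmetric])
  finally show ?thesis .
qed

lemma clearing_policy_QP: "1 \<le> q \<Longrightarrow> clearing_policy M N (QP N q)"
  using rate_pos stopping_time_arrival[of q]
  by (simp add: clearing_policy_def QP_def nn_integral_arrival_time)

lemma clearing_policy_TP2:
  assumes "0 < T" shows "clearing_policy M N (TP2 N T)"
proof -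
  have [measurable]: "arrival_time N 1 \<in> borel_measurable M"
    by (rule random_time_measurable[OF stopping_time_arrival])
  have "(\<integral>\<^sup>+\<omega>. TP2 N T \<omega> \<partial>M) = ennreal (1 / rate) + ennreal T"
    unfolding TP2_def using nn_integral_arrival_time[of 1]
    by (subst nn_integral_add) (simp_all add: emeasure_space_1 del: One_nat_def)
  then show ?thesis
    using stopping_time_TP2[OF assms] assms rate_pos
    by (simp add: clearing_policy_def add_pos_nonneg)
qed

lemma clearing_policy_HP2:
  assumes "1 \<le> q" "0 < T" shows "clearing_policy M N (HP2 N q T)"
proof -
  have mono: "arrival_time N 1 \<omega> \<le> arrival_time N q \<omega>" for \<omega>
    unfolding arrival_time_def using assms(1) by (intro Inf_superset_mono) auto
  have "(\<integral>\<^sup>+\<omega>. arrival_time N 1 \<omega> \<partial>M) \<le> (\<integral>\<^sup>+\<omega>. HP2 N q T \<omega> \<partial>M)"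
    using mono by (intro nn_integral_mono) (simp add: HP2_def)
  moreover have "0 < (\<integral>\<^sup>+\<omega>. arrival_time N 1 \<omega> \<partial>M)"
    using nn_integral_arrival_time[of 1] rate_pos by simp
  ultimately have "0 < (\<integral>\<^sup>+\<omega>. HP2 N q T \<omega> \<partial>M)"
    by (rule order.strict_trans2[rotated])
  moreover have "(\<integral>\<^sup>+\<omega>. HP2 N q T \<omega> \<partial>M) \<le> (\<integral>\<^sup>+\<omega>. arrival_time N q \<omega> \<partial>M)"
    by (intro nn_integral_mono) (simp add: HP2_def)
  then have "(\<integral>\<^sup>+\<omega>. HP2 N q T \<omega> \<partial>M) < \<infinity>"
    by (simp add: nn_integral_arrival_time order.strict_trans1)
  ultimately show ?thesis
    using stopping_time_HP2[OF assms(2)] by (simp add: clearing_policy_def)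
qed

end

end

theory Submission
  imports Defs
begin

text \<open>
  The order count only moves up, so a cycle of length \<open>\<tau>\<close> spends a block of time in each state
  \<open>k = 0, 1, 2, \<dots>\<close>. If \<open>S k\<close> is the expected time spent in state \<open>k\<close> before \<open>\<tau>\<close>, Fubini's theorem
  (\<open>occupation_formula\<close>) gives \<open>E[\<tau>] = \<Sum>k. S k\<close> and \<open>E[\<integral>\<^sub>0\<^sup>\<tau> N(u) du] = \<Sum>k. k * S k\<close>. Thus
  \<open>rate * AOD\<close> is the mean of \<open>k\<close> under the weights \<open>S k\<close>, and policies are compared through their
  weights.

  Stopping at the \<open>q\<close>-th arrival at the latest removes exactly the weights with \<open>k \<ge> q\<close> and leaves the
  others unchanged (\<open>expected_sojourn_min_arrival\<close>). Without any other stopping rule all weights equal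
  \<open>1 / rate\<close>. For TP2 the weight of \<open>k\<close> is \<open>P(N(T) \<ge> k) / rate\<close> (\<open>expected_sojourn_TP2\<close>): state \<open>k \<ge> 1\<close>
  is visited iff \<open>k - 1\<close> further orders come within \<open>T\<close> of the first one, an event of probability
  \<open>P(N(T) \<ge> k - 1)\<close>, and the visit may be cut short by the deadline. The weights therefore are:
  constant on \<open>k < q\<close> for QP, the strictly decreasing positive sequence \<open>P(N(T) \<ge> k) / rate\<close> on all
  \<open>k\<close> for TP2, and the same sequence restricted to \<open>k < q\<close> for HP2.

  Both comparisons are now statements about weighted means. Against QP, a strictly decreasing sequence
  of weights on \<open>{0, \<dots>, q - 1}\<close> has a smaller mean than the uniform one
  (\<open>decreasing_weights_mean_less\<close>); for this \<open>q \<ge> 2\<close> is essential. Against TP2, discarding the positive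
  weights of states \<open>k \<ge> q\<close> lowers the mean, since all remaining states are below \<open>q\<close>.
\<close>

section \<open>Expected sojourn times\<close>

text \<open>
  The strict inequalities \<open>0 < u\<close> and \<open>u < \<tau>\<close> alter the integral over a null set only; they are chosen
  because \<open>u < arrival_time N q\<close> is the same as \<open>N u < q\<close>.
\<close>

definition expected_sojourn ::
    "'a measure \<Rightarrow> (real \<Rightarrow> 'a \<Rightarrow> nat) \<Rightarrow> ('a \<Rightarrow> ennreal) \<Rightarrow> nat \<Rightarrow> ennreal" where
  "expected_sojourn M N \<tau> k =
    (\<integral>\<^sup>+u. indicator {0<..} u * emeasure M {\<omega> \<in> space M. N u \<omega> = k \<and> ennreal u < \<tau> \<omega>} \<partial>lborel)"

lemma nn_integral_initial_interval:
  "(\<integral>\<^sup>+u. indicator {u. 0 \<le> u \<and> ennreal u \<le> x} u \<partial>lborel) = x"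
proof (cases x)
  case (real r)
  then have "{u. 0 \<le> u \<and> ennreal u \<le> x} = {0..r}" by (auto simp: ennreal_le_iff)
  with real show ?thesis by simp
next
  case top
  then have eq: "{u. 0 \<le> u \<and> ennreal u \<le> x} = {0..}" by auto
  have le: "of_nat n \<le> emeasure lborel {0::real..}" for n
  proof -
    have "emeasure lborel {0..real n} \<le> emeasure lborel {0::real..}"
      by (rule emeasure_mono) auto
    then show ?thesis by (simp add: ennreal_of_nat_eq_real_of_nat)
  qed
  have "emeasure lborel {0::real..} = top"
    using ennreal_Ex_less_of_nat[of "emeasure lborel {0::real..}"] le
    by (auto simp: less_top[symmetric] not_less[symmetric])
  with top eq show ?thesis by simp
qed

lemma AE_initial_interval_eq_open:
  "AE u in lborel. (0 \<le> u \<and> ennreal u \<le> x) = (0 < u \<and> ennreal u < x)"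
proof -
  have "AE u in lborel. u \<noteq> (0::real)" "AE u in lborel. u \<noteq> enn2real x"
    by (rule AE_lborel_singleton)+
  then show ?thesis
    by eventually_elim (auto simp: less_le)
qed

lemma sum_of_nat_mult_ennreal:
  assumes "\<And>k. 0 \<le> s k"
  shows "(\<Sum>k\<in>A. of_nat k * ennreal (s k)) = ennreal (\<Sum>k\<in>A. real k * s k)"
proof -
  have "(\<Sum>k\<in>A. of_nat k * ennreal (s k)) = (\<Sum>k\<in>A. ennreal (real k * s k))"
    by (rule sum.cong) (simp_all add: ennreal_of_nat_eq_real_of_nat ennreal_mult assms)
  also have "\<dots> = ennreal (\<Sum>k\<in>A. real k * s k)"
    by (rule sum_ennreal) (simp add: assms)
  finally show ?thesis .
qed

section \<open>Tails and weighted means\<close>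

lemma prob_atLeast_eq_pmf_plus:
  "measure_pmf.prob p {k..} = pmf p k + measure_pmf.prob p {Suc k..}" for p :: "nat pmf"
proof -
  have "{k..} = {k} \<union> {Suc k..}" by auto
  moreover have "measure_pmf.prob p ({k} \<union> {Suc k..}) = pmf p k + measure_pmf.prob p {Suc k..}"
    by (subst measure_pmf.finite_measure_Union) (auto simp: measure_pmf_single)
  ultimately show ?thesis by (simp only:)
qed

lemma prob_atLeast_poisson_decreasing:
  "0 < \<mu> \<Longrightarrow> measure_pmf.prob (poisson_pmf \<mu>) {Suc k..} < measure_pmf.prob (poisson_pmf \<mu>) {k..}"
  by (simp add: prob_atLeast_eq_pmf_plus[of _ k])

lemma prob_atLeast_poisson_pos:
  "0 < \<mu> \<Longrightarrow> 0 < measure_pmf.prob (poisson_pmf \<mu>) {k..}"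
  using prob_atLeast_poisson_decreasing[of \<mu> k] by (rule order.strict_trans1[OF measure_nonneg])

text \<open>
  Decreasing weights push mass towards small indices, so the weighted mean of \<open>0, \<dots>, q - 1\<close> falls
  below the uniform mean. Passing from \<open>n\<close> to \<open>n + 1\<close> terms preserves the inequality because the new
  weight \<open>s n\<close> is smaller than each earlier one, hence smaller than their average.
\<close>

lemma decreasing_weights_mean_less:
  fixes s :: "nat \<Rightarrow> real"
  assumes "2 \<le> q" and pos: "\<And>k. 0 < s k" and dec: "\<And>k. s (Suc k) < s k"
  shows "(\<Sum>k<q. real k * s k) / (\<Sum>k<q. s k) < (real q - 1) / 2"
proof -
  have anti: "s j < s i" if "i < j" for i j
  proof -
    have "- s i < - s j"
      by (rule lift_Suc_mono_less[of "\<lambda>k. - s k"]) (simp_all add: dec that)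
    then show ?thesis by simp
  qed
  have last: "real n * s n < (\<Sum>k<n. s k)" if "0 < n" for n
  proof -
    have "(\<Sum>k<n. s n) < (\<Sum>k<n. s k)"
      using that by (intro sum_strict_mono) (simp_all add: anti lessThan_empty_iff)
    then show ?thesis by simp
  qed
  have "2 * (\<Sum>k<n. real k * s k) < (real n - 1) * (\<Sum>k<n. s k)" if "2 \<le> n" for n
    using that
  proof (induction n rule: dec_induct)
    case base
    have "{..<2::nat} = {0, 1}" by auto
    then show ?case using dec[of 0] by simp
  next
    case (step n)
    then show ?case using last[of n] by (simp add: algebra_simps)
  qed
  from this[OF assms(1)] have "2 * (\<Sum>k<q. real k * s k) < (real q - 1) * (\<Sum>k<q. s k)" .
  moreover have "0 < (\<Sum>k<q. s k)"
    using assms(1) pos by (intro sum_pos) (auto simp: lessThan_empty_iff)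
  ultimately show ?thesis using assms(1) by (simp add: pos_divide_less_eq mult.commute)
qed

section \<open>Sojourn times determine the average order delay\<close>

context poisson_process
begin

lemma arrival_time_measurable [measurable]: "arrival_time N n \<in> borel_measurable M"
  by (rule random_time_measurable[OF stopping_time_arrival])

lemma less_arrival_time_iff:
  assumes "\<omega> \<in> space M" "0 \<le> r"
  shows "ennreal r < arrival_time N n \<omega> \<longleftrightarrow> N r \<omega> < n"
  using arrival_time_le_iff[OF assms, of n] by (simp add: not_le[symmetric])

text \<open>
  Split the path integral according to the current state and exchange the integrals over outcomes and
  time. As \<open>f\<close> is arbitrary, the choice \<open>f = 1\<close> yields the expected cycle length and \<open>f = of_nat\<close> the
  expected accumulated delay.
\<close>

theorem occupation_formula:
  assumes [measurable]: "\<tau> \<in> borel_measurable M"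
  shows "(\<integral>\<^sup>+\<omega>. (\<integral>\<^sup>+u. f (N u \<omega>) * indicator {u. 0 \<le> u \<and> ennreal u \<le> \<tau> \<omega>} u \<partial>lborel) \<partial>M)
    = (\<Sum>k. f k * expected_sojourn M N \<tau> k)"
proof -
  interpret P: pair_sigma_finite M "lborel :: real measure" ..
  \<comment> \<open>State \<open>k\<close> is occupied between the arrivals \<open>k\<close> and \<open>k + 1\<close>. In terms of arrival times the
    event is jointly measurable in time and outcome, as \<open>N\<close> itself is only assumed to be measurable
    at each fixed time.\<close>
  define G where "G k \<omega> u \<longleftrightarrow> 0 < u \<and> ennreal u < \<tau> \<omega> \<and>
      arrival_time N k \<omega> \<le> ennreal u \<and> ennreal u < arrival_time N (Suc k) \<omega>" for k \<omega> u
  have G_meas [measurable]: "Measurable.pred (M \<Otimes>\<^sub>M lborel) (\<lambda>(\<omega>, u). G k \<omega> u)" for k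
    unfolding G_def by measurable
  have G_iff: "G k \<omega> u \<longleftrightarrow> 0 < u \<and> ennreal u < \<tau> \<omega> \<and> N u \<omega> = k" if "\<omega> \<in> space M" for k \<omega> u
    using that arrival_time_le_iff[OF that, of u k] less_arrival_time_iff[OF that, of u "Suc k"]
    by (cases "0 < u") (auto simp: G_def)
  have sojourn: "expected_sojourn M N \<tau> k = (\<integral>\<^sup>+\<omega>. (\<integral>\<^sup>+u. of_bool (G k \<omega> u) \<partial>lborel) \<partial>M)" for k
  proof -
    have "indicator {0<..} u * emeasure M {\<omega> \<in> space M. N u \<omega> = k \<and> ennreal u < \<tau> \<omega>} =
        (\<integral>\<^sup>+\<omega>. of_bool (G k \<omega> u) \<partial>M)" for u
    proof -
      have "Measurable.pred M (\<lambda>\<omega>. G k \<omega> u)"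
        unfolding G_def by measurable
      then have "{\<omega> \<in> space M. G k \<omega> u} \<in> sets M" by (simp add: pred_def)
      then have "emeasure M {\<omega> \<in> space M. G k \<omega> u} =
          (\<integral>\<^sup>+\<omega>. indicator {\<omega> \<in> space M. G k \<omega> u} \<omega> \<partial>M)"
        by (rule nn_integral_indicator[symmetric])
      also have "\<dots> = (\<integral>\<^sup>+\<omega>. of_bool (G k \<omega> u) \<partial>M)"
        by (rule nn_integral_cong) (simp add: indicator_def)
      finally have "(\<integral>\<^sup>+\<omega>. of_bool (G k \<omega> u) \<partial>M) = emeasure M {\<omega> \<in> space M. G k \<omega> u}" ..
      also have "{\<omega> \<in> space M. G k \<omega> u} =
          (if 0 < u then {\<omega> \<in> space M. N u \<omega> = k \<and> ennreal u < \<tau> \<omega>} else {})"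
        by (auto simp: G_iff)
      finally show ?thesis by simp
    qed
    then have "expected_sojourn M N \<tau> k = (\<integral>\<^sup>+u. (\<integral>\<^sup>+\<omega>. of_bool (G k \<omega> u) \<partial>M) \<partial>lborel)"
      by (simp add: expected_sojourn_def)
    also have "\<dots> = (\<integral>\<^sup>+\<omega>. (\<integral>\<^sup>+u. of_bool (G k \<omega> u) \<partial>lborel) \<partial>M)"
      by (rule P.Fubini') measurable
    finally show ?thesis .
  qed
  have path: "(\<integral>\<^sup>+u. f (N u \<omega>) * indicator {u. 0 \<le> u \<and> ennreal u \<le> \<tau> \<omega>} u \<partial>lborel) =
      (\<Sum>k. f k * (\<integral>\<^sup>+u. of_bool (G k \<omega> u) \<partial>lborel))" if w: "\<omega> \<in> space M" for \<omega>
  proof -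
    have [measurable]: "Measurable.pred lborel (G k \<omega>)" for k
      unfolding G_def[abs_def] by measurable
    have "(\<integral>\<^sup>+u. f (N u \<omega>) * indicator {u. 0 \<le> u \<and> ennreal u \<le> \<tau> \<omega>} u \<partial>lborel) =
        (\<integral>\<^sup>+u. (\<Sum>k. f k * of_bool (G k \<omega> u)) \<partial>lborel)"
    proof (rule nn_integral_cong_AE)
      show "AE u in lborel. f (N u \<omega>) * indicator {u. 0 \<le> u \<and> ennreal u \<le> \<tau> \<omega>} u =
          (\<Sum>k. f k * of_bool (G k \<omega> u))"
        using AE_initial_interval_eq_open[of "\<tau> \<omega>"]
      proof eventually_elim
        fix u assume eq: "(0 \<le> u \<and> ennreal u \<le> \<tau> \<omega>) = (0 < u \<and> ennreal u < \<tau> \<omega>)"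
        have "(\<Sum>k. f k * of_bool (G k \<omega> u)) = (\<Sum>k\<in>{N u \<omega>}. f k * of_bool (G k \<omega> u))"
          by (rule suminf_finite) (auto simp: G_iff[OF w])
        then show "f (N u \<omega>) * indicator {u. 0 \<le> u \<and> ennreal u \<le> \<tau> \<omega>} u =
            (\<Sum>k. f k * of_bool (G k \<omega> u))"
          using eq by (auto simp: G_iff[OF w] indicator_def)
      qed
    qed
    also have "\<dots> = (\<Sum>k. \<integral>\<^sup>+u. f k * of_bool (G k \<omega> u) \<partial>lborel)"
      by (rule nn_integral_suminf) measurable
    finally show ?thesis by (simp add: nn_integral_cmult)
  qed
  have "(\<integral>\<^sup>+\<omega>. (\<integral>\<^sup>+u. f (N u \<omega>) * indicator {u. 0 \<le> u \<and> ennreal u \<le> \<tau> \<omega>} u \<partial>lborel) \<partial>M) =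
      (\<integral>\<^sup>+\<omega>. (\<Sum>k. f k * (\<integral>\<^sup>+u. of_bool (G k \<omega> u) \<partial>lborel)) \<partial>M)"
    by (rule nn_integral_cong) (rule path)
  also have "\<dots> = (\<Sum>k. \<integral>\<^sup>+\<omega>. f k * (\<integral>\<^sup>+u. of_bool (G k \<omega> u) \<partial>lborel) \<partial>M)"
    by (rule nn_integral_suminf) measurable
  also have "\<dots> = (\<Sum>k. f k * expected_sojourn M N \<tau> k)"
    unfolding sojourn by (intro suminf_cong nn_integral_cmult) measurable
  finally show ?thesis .
qed

corollary nn_integral_eq_sum_sojourn:
  assumes "\<tau> \<in> borel_measurable M"
  shows "(\<integral>\<^sup>+\<omega>. \<tau> \<omega> \<partial>M) = (\<Sum>k. expected_sojourn M N \<tau> k)"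
  using occupation_formula[OF assms, of "\<lambda>_. 1"]
  by (simp add: nn_integral_initial_interval)

corollary AOD_eq_sojourn:
  assumes "\<tau> \<in> borel_measurable M"
  shows "AOD M rate N \<tau> = (\<Sum>k. of_nat k * expected_sojourn M N \<tau> k) /
    (ennreal rate * (\<Sum>k. expected_sojourn M N \<tau> k))"
  unfolding AOD_def occupation_formula[OF assms] nn_integral_eq_sum_sojourn[OF assms] ..

text \<open>
  Before the \<open>q\<close>-th arrival the process visits the states below \<open>q\<close> and no others, and a visit to such
  a state always ends by that arrival.
\<close>

lemma expected_sojourn_min_arrival:
  "expected_sojourn M N (\<lambda>\<omega>. min (arrival_time N q \<omega>) (\<sigma> \<omega>)) k =
    (if k < q then expected_sojourn M N \<sigma> k else 0)"
proof -
  have "indicator {0<..} u *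
      emeasure M {\<omega> \<in> space M. N u \<omega> = k \<and> ennreal u < min (arrival_time N q \<omega>) (\<sigma> \<omega>)} =
    (if k < q then indicator {0<..} u * emeasure M {\<omega> \<in> space M. N u \<omega> = k \<and> ennreal u < \<sigma> \<omega>} else 0)"
    for u
  proof (cases "0 < u")
    case True
    then have "{\<omega> \<in> space M. N u \<omega> = k \<and> ennreal u < min (arrival_time N q \<omega>) (\<sigma> \<omega>)} =
      (if k < q then {\<omega> \<in> space M. N u \<omega> = k \<and> ennreal u < \<sigma> \<omega>} else {})"
      using less_arrival_time_iff[of _ u q] by auto
    then show ?thesis by simp
  qed simp
  then show ?thesis unfolding expected_sojourn_def by simp
qed

lemma AOD_min_arrival:
  assumes "\<sigma> \<in> borel_measurable M" "1 \<le> q"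
    and s: "\<And>k. expected_sojourn M N \<sigma> k = ennreal (s k)" "\<And>k. 0 < s k"
  shows "AOD M rate N (\<lambda>\<omega>. min (arrival_time N q \<omega>) (\<sigma> \<omega>)) =
    ennreal ((\<Sum>k<q. real k * s k) / (rate * (\<Sum>k<q. s k)))"
proof -
  let ?\<tau> = "\<lambda>\<omega>. min (arrival_time N q \<omega>) (\<sigma> \<omega>)"
  have [measurable]: "?\<tau> \<in> borel_measurable M" using assms(1) by measurable
  have pos: "0 < (\<Sum>k<q. s k)"
    using assms(2) s(2) by (intro sum_pos) (auto simp: lessThan_empty_iff)
  have "(\<Sum>k. g k * expected_sojourn M N ?\<tau> k) = (\<Sum>k<q. g k * ennreal (s k))" for g
    by (subst suminf_finite[of "{..<q}"]) (auto simp: expected_sojourn_min_arrival s(1))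
  note this[of of_nat] this[of "\<lambda>_. 1"]
  moreover have "(\<Sum>k<q. of_nat k * ennreal (s k)) = ennreal (\<Sum>k<q. real k * s k)"
    using s(2) by (simp add: sum_of_nat_mult_ennreal less_imp_le)
  moreover have "(\<Sum>k<q. ennreal (s k)) = ennreal (\<Sum>k<q. s k)"
    using s(2) by (simp add: sum_ennreal less_imp_le)
  ultimately show ?thesis
    using pos rate_pos s(2)
    by (simp add: AOD_eq_sojourn ennreal_mult[symmetric] divide_ennreal sum_nonneg less_imp_le)
qed

section \<open>Sojourn times without a deadline and under TP2\<close>

text \<open>
  As a function of time, the probability of being in state \<open>k\<close> is proportional to the density of the
  \<open>(k + 1)\<close>-st arrival, so integrals over time become values of the Erlang distribution function.
\<close>

lemma pmf_poisson_eq_erlang: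
  assumes "0 < u" shows "pmf (poisson_pmf (rate * u)) k = erlang_density k rate u / rate"
  using assms rate_pos by (simp add: erlang_density_def field_simps power_mult_distrib)

lemma emeasure_N_eq_pmf:
  assumes "0 < u"
  shows "emeasure M {\<omega> \<in> space M. N u \<omega> = k} = ennreal (pmf (poisson_pmf (rate * u)) k)"
  using assms rate_pos by (simp add: emeasure_N)

lemma expected_sojourn_infinite: "expected_sojourn M N (\<lambda>_. \<infinity>) k = ennreal (1 / rate)"
proof -
  have "expected_sojourn M N (\<lambda>_. \<infinity>) k =
      (\<integral>\<^sup>+u. ennreal (1 / rate) * ennreal (erlang_density k rate u) \<partial>lborel)"
    unfolding expected_sojourn_def
  proof (rule nn_integral_cong_AE)
    have "AE u in lborel. u \<noteq> (0::real)" by (rule AE_lborel_singleton)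
    then show "AE u in lborel. indicator {0<..} u *
        emeasure M {\<omega> \<in> space M. N u \<omega> = k \<and> ennreal u < \<infinity>} =
        ennreal (1 / rate) * ennreal (erlang_density k rate u)"
    proof eventually_elim
      fix u :: real assume "u \<noteq> 0"
      then show "indicator {0<..} u * emeasure M {\<omega> \<in> space M. N u \<omega> = k \<and> ennreal u < \<infinity>} =
        ennreal (1 / rate) * ennreal (erlang_density k rate u)"
        using rate_pos emeasure_N_eq_pmf[of u k] pmf_poisson_eq_erlang[of u k]
        by (cases "0 < u") (simp_all add: ennreal_mult[symmetric] erlang_density_def)
    qed
  qed
  also have "\<dots> = ennreal (1 / rate) * (\<integral>\<^sup>+u. ennreal (erlang_density k rate u) \<partial>lborel)"
    by (rule nn_integral_cmult) simp
  also have "(\<integral>\<^sup>+u. ennreal (erlang_density k rate u) \<partial>lborel) = 1"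
    using nn_integral_erlang_ith_moment[OF rate_pos, of k 0] by simp
  finally show ?thesis by simp
qed

text \<open>
  The increments over \<open>[0, s]\<close> and \<open>[s, u]\<close> are independent. This replaces the strong Markov property
  at the first arrival: beyond the fixed time \<open>T\<close>, the event \<open>u < \<tau>\<^sub>1 + T\<close> says that no order has
  arrived by time \<open>u - T\<close>.
\<close>

lemma emeasure_N_consecutive:
  assumes "0 < s" "s < u"
  shows "emeasure M {\<omega> \<in> space M. N s \<omega> = 0 \<and> N u \<omega> = k} =
    ennreal (exp (- (rate * s)) * pmf (poisson_pmf (rate * (u - s))) k)"
proof -
  define ts where "ts i = (if i = 0 then 0 else if i = 1 then s else u)" for i :: nat
  define X where "X i \<omega> = N (ts (Suc i)) \<omega> - N (ts i) \<omega>" for i \<omega>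
  have Ns: "emeasure M {\<omega> \<in> space M. N s \<omega> = 0} = ennreal (exp (- (rate * s)))"
    using emeasure_N[OF assms(1), of 0] by simp
  have indep: "indep_vars (\<lambda>_. count_space UNIV) X {..<2}"
    unfolding X_def using assms by (intro N_indep_increments) (auto simp: ts_def)
  have X0: "X 0 \<omega> = N s \<omega>" if "\<omega> \<in> space M" for \<omega> using that by (simp add: X_def ts_def N_zero)
  have X1: "X 1 = (\<lambda>\<omega>. N u \<omega> - N s \<omega>)" by (simp add: X_def[abs_def] ts_def)
  have X_meas: "X 1 \<in> measurable M (count_space UNIV)"
    using indep by (auto simp: indep_vars_def)
  \<comment> \<open>The event prescribes the increment \<open>0\<close> on \<open>[0, s]\<close> and \<open>k\<close> on \<open>[s, u]\<close>.\<close>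
  have "prob (\<Inter>i\<in>{..<2}. X i -` (if i = 0 then {0} else {k}) \<inter> space M) =
      (\<Prod>i<2. prob (X i -` (if i = 0 then {0} else {k}) \<inter> space M))"
    by (rule indep_varsD[OF indep]) (simp_all add: lessThan_empty_iff)
  moreover have "{..<2::nat} = {0, 1}" by auto
  moreover have "X 0 -` {0} \<inter> space M = {\<omega> \<in> space M. N s \<omega> = 0}" by (auto simp: X0)
  ultimately have "prob ({\<omega> \<in> space M. N s \<omega> = 0} \<inter> (X 1 -` {k} \<inter> space M)) =
      prob {\<omega> \<in> space M. N s \<omega> = 0} * prob (X 1 -` {k} \<inter> space M)"
    by simp
  moreover have "{\<omega> \<in> space M. N s \<omega> = 0} \<inter> (X 1 -` {k} \<inter> space M) =
      {\<omega> \<in> space M. N s \<omega> = 0 \<and> N u \<omega> = k}"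
    using assms N_mono[of _ s u] unfolding X1 by force
  moreover have "prob {\<omega> \<in> space M. N s \<omega> = 0} = exp (- (rate * s))"
    using Ns by (simp add: emeasure_eq_measure)
  moreover have "prob (X 1 -` {k} \<inter> space M) = pmf (poisson_pmf (rate * (u - s))) k"
  proof -
    have "prob (X 1 -` {k} \<inter> space M) = measure (distr M (count_space UNIV) (X 1)) {k}"
      using X_meas by (subst measure_distr) auto
    also have "distr M (count_space UNIV) (X 1) = measure_pmf (poisson_pmf (rate * (u - s)))"
      unfolding X1 using assms by (intro N_increments) auto
    finally show ?thesis by (simp add: measure_pmf_single)
  qed
  ultimately show ?thesis by (simp add: emeasure_eq_measure)
qed

lemma TP2_measurable:
  assumes "0 < T" shows "TP2 N T \<in> borel_measurable M"
  by (rule random_time_measurable[OF stopping_time_TP2[OF assms]])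

lemma less_TP2_iff:
  assumes "\<omega> \<in> space M" "0 < T" "0 \<le> u"
  shows "ennreal u < TP2 N T \<omega> \<longleftrightarrow> u \<le> T \<or> N (u - T) \<omega> = 0"
proof (cases "u \<le> T")
  case True
  have "0 < arrival_time N 1 \<omega>"
    using less_arrival_time_iff[OF assms(1), of 0 1] assms(1) by (simp add: N_zero)
  then have "ennreal T < TP2 N T \<omega>"
    using ennreal_add_left_cancel_less[of "ennreal T" 0 "arrival_time N 1 \<omega>"]
    by (simp add: TP2_def add.commute[of _ "ennreal T"])
  with True show ?thesis using ennreal_leI[OF True] by (simp add: order.strict_trans1)
next
  case False
  then have "ennreal u = ennreal T + ennreal (u - T)"
    using assms by (simp add: ennreal_plus[symmetric] del: ennreal_plus)
  then have "ennreal u < TP2 N T \<omega> \<longleftrightarrow> ennreal (u - T) < arrival_time N 1 \<omega>"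
    by (simp add: TP2_def add.commute[of _ "ennreal T"] ennreal_add_left_cancel_less)
  with False less_arrival_time_iff[OF assms(1), of "u - T" 1] show ?thesis by simp
qed

text \<open>
  Up to time \<open>T\<close> the deadline cannot have passed, and the time in state \<open>k\<close> contributes
  \<open>P(N(T) \<ge> k + 1) / rate\<close> by the Erlang distribution function. At a later time \<open>u\<close>, no order may have
  arrived by \<open>u - T\<close> and \<open>k\<close> orders must have arrived since; integrating the exponential factor
  \<open>exp (- rate * (u - T))\<close> leaves \<open>P(N(T) = k) / rate\<close>. The two parts add up to the stated tail.
\<close>

lemma expected_sojourn_TP2:
  assumes "0 < T"
  shows "expected_sojourn M N (TP2 N T) k =
    ennreal (measure_pmf.prob (poisson_pmf (rate * T)) {k..} / rate)"
proof -
  let ?p = "pmf (poisson_pmf (rate * T))"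
  let ?e = "erlang_density k rate" and ?exp = "erlang_density 0 rate"
  have [simp]: "0 \<le> rate" using rate_pos by simp
  have "expected_sojourn M N (TP2 N T) k =
      (\<integral>\<^sup>+u. ennreal (1 / rate) * (ennreal (?e u) * indicator {..T} u) +
            ennreal (?p k / rate) * ennreal (?exp (u - T)) \<partial>lborel)"
    unfolding expected_sojourn_def
  proof (rule nn_integral_cong_AE)
    have "AE u in lborel. u \<noteq> (0::real)" "AE u in lborel. u \<noteq> T" by (rule AE_lborel_singleton)+
    then show "AE u in lborel. indicator {0<..} u *
        emeasure M {\<omega> \<in> space M. N u \<omega> = k \<and> ennreal u < TP2 N T \<omega>} =
      ennreal (1 / rate) * (ennreal (?e u) * indicator {..T} u) +
      ennreal (?p k / rate) * ennreal (?exp (u - T))"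
    proof eventually_elim
      fix u :: real assume u: "u \<noteq> 0" "u \<noteq> T"
      let ?E = "{\<omega> \<in> space M. N u \<omega> = k \<and> ennreal u < TP2 N T \<omega>}"
      consider "u < 0" | "0 < u" "u < T" | "T < u" using u by linarith
      then show "indicator {0<..} u * emeasure M ?E =
        ennreal (1 / rate) * (ennreal (?e u) * indicator {..T} u) +
        ennreal (?p k / rate) * ennreal (?exp (u - T))"
      proof cases
        case 1
        then show ?thesis using assms by (simp add: erlang_density_def)
      next
        case 2
        then have "?E = {\<omega> \<in> space M. N u \<omega> = k}"
          using assms by (auto simp: less_TP2_iff)
        then have "emeasure M ?E = ennreal (?e u / rate)"
          using 2 by (simp only: emeasure_N_eq_pmf pmf_poisson_eq_erlang)
        with 2 show ?thesis by (simp add: ennreal_mult[symmetric] erlang_density_def[of 0])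
      next
        case 3
        then have "?E = {\<omega> \<in> space M. N (u - T) \<omega> = 0 \<and> N u \<omega> = k}"
          using assms by (auto simp: less_TP2_iff)
        then have "emeasure M ?E = ennreal (exp (- (rate * (u - T))) * ?p k)"
          using emeasure_N_consecutive[of "u - T" u k] 3 assms by simp
        also have "exp (- (rate * (u - T))) * ?p k = ?p k / rate * ?exp (u - T)"
          using 3 rate_pos by (simp add: erlang_density_def)
        finally show ?thesis using 3 assms by (simp add: ennreal_mult[symmetric] del: pmf_poisson)
      qed
    qed
  qed
  also have "\<dots> = ennreal (1 / rate) * (\<integral>\<^sup>+u. ennreal (?e u) * indicator {..T} u \<partial>lborel) +
      ennreal (?p k / rate) * (\<integral>\<^sup>+u. ennreal (?exp (u - T)) \<partial>lborel)"
    by (subst nn_integral_add) (simp_all add: nn_integral_cmult del: pmf_poisson)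
  also have "(\<integral>\<^sup>+u. ennreal (?e u) * indicator {..T} u \<partial>lborel) = erlang_CDF k rate T"
    using rate_pos assms by (intro nn_integral_erlang_density) auto
  also have "(\<integral>\<^sup>+u. ennreal (?exp (u - T)) \<partial>lborel) = (\<integral>\<^sup>+u. ennreal (?exp u) \<partial>lborel)"
    by (subst nn_integral_real_affine[of _ 1 "- T"]) (simp_all add: lborel_distr_plus)
  also have "\<dots> = 1"
    using nn_integral_erlang_ith_moment[OF rate_pos, of 0 0] by simp
  also have "erlang_CDF k rate T = measure_pmf.prob (poisson_pmf (rate * T)) {Suc k..}"
  proof -
    have "measure_pmf.prob (poisson_pmf (rate * T)) {Suc k..} =
        1 - measure_pmf.prob (poisson_pmf (rate * T)) {..k}"
      using measure_pmf.prob_compl[of "{..k}" "poisson_pmf (rate * T)"]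
      by (simp add: Compl_eq_Diff_UNIV[symmetric] Compl_atMost atLeast_Suc_greaterThan)
    also have "measure_pmf.prob (poisson_pmf (rate * T)) {..k} = (\<Sum>n\<le>k. ?p n)"
      by (rule measure_measure_pmf_finite) simp
    finally show ?thesis using assms rate_pos by (simp add: erlang_CDF_def)
  qed
  also have "ennreal (1 / rate) * ennreal (measure_pmf.prob (poisson_pmf (rate * T)) {Suc k..}) +
      ennreal (?p k / rate) * 1 =
      ennreal (measure_pmf.prob (poisson_pmf (rate * T)) {k..} / rate)"
    using rate_pos by (simp add: ennreal_mult[symmetric] ennreal_plus[symmetric] prob_atLeast_eq_pmf_plus[of _ k]
      add_divide_distrib del: ennreal_plus pmf_poisson)
  finally show ?thesis .
qed

section \<open>Comparison of the policies\<close>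

text \<open>
  HP2 and QP are both the \<open>q\<close>-th arrival capped by a time (TP2 and \<open>\<infinity>\<close>), so
  \<open>AOD_min_arrival\<close> applies to both.
\<close>

lemma HP2_eq_min: "HP2 N q T = (\<lambda>\<omega>. min (arrival_time N q \<omega>) (TP2 N T \<omega>))"
  by (simp add: HP2_def[abs_def] TP2_def)

theorem AOD_HP2_less_QP:
  assumes "2 \<le> q" "0 < T"
  shows "AOD M rate N (HP2 N q T) < AOD M rate N (QP N q)"
proof -
  define s where "s k = measure_pmf.prob (poisson_pmf (rate * T)) {k..} / rate" for k
  have pos: "0 < s k" for k
    unfolding s_def using rate_pos assms(2)
    by (intro divide_pos_pos prob_atLeast_poisson_pos mult_pos_pos)
  have dec: "s (Suc k) < s k" for k
    unfolding s_def using rate_pos assms(2)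
    by (intro divide_strict_right_mono prob_atLeast_poisson_decreasing mult_pos_pos)
  have QP: "QP N q = (\<lambda>\<omega>. min (arrival_time N q \<omega>) \<infinity>)"
    by (simp add: QP_def)
  have "AOD M rate N (HP2 N q T) = ennreal ((\<Sum>k<q. real k * s k) / (rate * (\<Sum>k<q. s k)))"
    unfolding HP2_eq_min using assms pos
    by (intro AOD_min_arrival TP2_measurable) (auto simp: expected_sojourn_TP2 s_def)
  also have "\<dots> < ennreal ((real q - 1) / 2 / rate)"
    using decreasing_weights_mean_less[of q s] pos dec assms(1) rate_pos
    by (intro ennreal_lessI) (auto simp: field_simps)
  also have "\<dots> = AOD M rate N (QP N q)"
  proof -
    have gauss: "(\<Sum>k<n. real k) = real n * (real n - 1) / 2" for n
      by (induction n) (auto simp: field_simps)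
    have "AOD M rate N (QP N q) =
        ennreal ((\<Sum>k<q. real k * (1 / rate)) / (rate * (\<Sum>k<q. 1 / rate)))"
      unfolding QP using assms rate_pos
      by (intro AOD_min_arrival expected_sojourn_infinite) auto
    also have "(\<Sum>k<q. real k * (1 / rate)) = real q * (real q - 1) / 2 / rate"
      by (simp only: sum_distrib_right[symmetric] gauss) simp
    finally show ?thesis using assms rate_pos by simp
  qed
  finally show ?thesis .
qed

text \<open>
  With \<open>a\<close> and \<open>c\<close> the delay and the duration coming from states below \<open>q\<close>, the mean for HP2 is
  \<open>a / c < q\<close>. TP2 adds a duration \<open>d > 0\<close> spent in states that are at least \<open>q\<close>, hence a delay of at
  least \<open>q * d\<close>, which raises the mean.
\<close>

theorem AOD_HP2_less_TP2:
  assumes "1 \<le> q" "0 < T"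
  shows "AOD M rate N (HP2 N q T) < AOD M rate N (TP2 N T)"
proof -
  define s where "s k = measure_pmf.prob (poisson_pmf (rate * T)) {k..} / rate" for k
  define S where "S = expected_sojourn M N (TP2 N T)"
  have S: "S k = ennreal (s k)" for k unfolding S_def s_def by (rule expected_sojourn_TP2[OF assms(2)])
  have pos: "0 < s k" for k
    unfolding s_def using rate_pos assms(2)
    by (intro divide_pos_pos prob_atLeast_poisson_pos mult_pos_pos)
  define a c d where "a = (\<Sum>k<q. real k * s k)" and "c = (\<Sum>k<q. s k)"
    and "d = enn2real (\<Sum>k. S (k + q))"
  have c: "0 < c"
    unfolding c_def using assms(1) pos by (intro sum_pos) (auto simp: lessThan_empty_iff)
  have a: "0 \<le> a" unfolding a_def using pos by (intro sum_nonneg) (simp add: less_imp_le)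
  have a_less: "a < real q * c"
    unfolding a_def c_def sum_distrib_left using assms(1) pos
    by (intro sum_strict_mono) (auto simp: lessThan_empty_iff)
  have split: "(\<Sum>k. f k) = (\<Sum>k. f (k + q)) + (\<Sum>k<q. f k)" for f :: "nat \<Rightarrow> ennreal"
    by (rule suminf_offset) simp
  have head: "(\<Sum>k<q. S k) = ennreal c" "(\<Sum>k<q. of_nat k * S k) = ennreal a"
    unfolding c_def a_def S using pos
    by (simp_all add: sum_of_nat_mult_ennreal sum_ennreal less_imp_le)
  have total: "(\<Sum>k. S k) < \<infinity>"
    using clearing_policy_TP2[OF assms(2)] nn_integral_eq_sum_sojourn[OF TP2_measurable[OF assms(2)]]
    by (simp add: S_def clearing_policy_def)
  then have tail: "(\<Sum>k. S (k + q)) = ennreal d"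
    unfolding split[of S] d_def by (simp add: less_top)
  have "0 < S q" using pos[of q] by (simp add: S)
  also have "S q \<le> ennreal d"
    unfolding tail[symmetric] using sum_le_suminf[of "\<lambda>k. S (k + q)" "{0}"] by simp
  finally have d: "0 < d" by simp
  have "AOD M rate N (HP2 N q T) = ennreal (a / (rate * c))"
    unfolding HP2_eq_min a_def c_def using assms pos
    by (intro AOD_min_arrival TP2_measurable) (auto simp: S[unfolded S_def])
  also have "\<dots> < ennreal ((a + real q * d) / (rate * (c + d)))"
  proof (rule ennreal_lessI)
    have "a * d < real q * c * d" using a_less d by (rule mult_strict_right_mono)
    then have "a * (c + d) < (a + real q * d) * c" by (simp add: algebra_simps)
    then have "a / c < (a + real q * d) / (c + d)" using c d by (simp add: divide_simps)
    then have "a / c / rate < (a + real q * d) / (c + d) / rate"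
      using rate_pos by (rule divide_strict_right_mono)
    then show "a / (rate * c) < (a + real q * d) / (rate * (c + d))"
      by (simp add: mult.commute)
    show "0 < (a + real q * d) / (rate * (c + d))"
      using a c d rate_pos assms(1) by (intro divide_pos_pos add_nonneg_pos mult_pos_pos) auto
  qed
  also have "\<dots> = (of_nat q * ennreal d + ennreal a) / (ennreal rate * (ennreal d + ennreal c))"
    using a c d rate_pos
    by (simp add: divide_ennreal[symmetric] ennreal_mult ennreal_of_nat_eq_real_of_nat add.commute)
  also have "\<dots> \<le> AOD M rate N (TP2 N T)"
  proof -
    have "of_nat q * ennreal d = (\<Sum>k. of_nat q * S (k + q))"
      by (simp add: tail[symmetric])
    also have "\<dots> \<le> (\<Sum>k. of_nat (k + q) * S (k + q))"
      by (intro suminf_le mult_right_mono) (auto simp: ennreal_of_nat_eq_real_of_nat)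
    finally show ?thesis
      unfolding AOD_eq_sojourn[OF TP2_measurable[OF assms(2)]] S_def[symmetric]
        split[of S] split[of "\<lambda>k. of_nat k * S k"] head tail
      by (intro divide_right_mono_ennreal add_right_mono)
  qed
  finally show ?thesis .
qed

end

theorem theorem6p2:
  fixes M :: "'a measure" and rate T :: real and N :: "real \<Rightarrow> 'a \<Rightarrow> nat" and q :: nat
  assumes "poisson_process M rate N"
    and "1 \<le> q"
    and "0 < T"
  shows "(q \<noteq> 1 \<longrightarrow> AOD M rate N (HP2 N q T) < AOD M rate N (QP N q)) \<and>
    AOD M rate N (HP2 N q T) < AOD M rate N (TP2 N T)"
proof -
  interpret poisson_process M rate N by fact
  show ?thesis
    using AOD_HP2_less_QP[of q T] AOD_HP2_less_TP2[of q T] assms(2,3) by auto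
qed

end
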